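(* Let $\beta>0$ be a real number and let $p$ be analytic in $\mathbb{D}$ with $p(0)=1$. If $$p^2(z)+\frac{\beta zp'(z)}{p(z)}\prec 1+z,$$ then $p(z)\prec\sqrt{1+z}$.
   Context: $\mathbb{D}=\{z\in\mathbb{C}:|z|<1\}$; $p^k(z)=(p(z))^k$. For analytic $f,g$ on $\mathbb{D}$, $f\prec g$ ($f$ is subordinate to $g$) means there is an analytic $w:\mathbb{D}\to\mathbb{D}$ with $w(0)=0$ and $f(z)=g(w(z))$ for all $z\in\mathbb{D}$; in particular the left-hand side of a subordination is understood to be an analytic function on $\mathbb{D}$. $\sqrt{1+z}$ is the principal branch; it maps $\mathbb{D}$ univalently onto $\{w:|w^2-1|<1,\ \operatorname{Re}w>0\}$. *)

theory Defs
  imports "HOL-Complex_Analysis.Complex_Analysis"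
begin

abbreviation unit_disc :: "complex set"
  where "unit_disc \<equiv> ball 0 1"

(* Analyticity of f is part of the relation. Hence for a quotient such as
   z * deriv p z / p z with p 0 = 1 the convention x / 0 = 0 is harmless: at a zero of p
   the quotient has a pole, so it is not holomorphic there whatever its value at the point. *)
definition subordinate :: "(complex \<Rightarrow> complex) \<Rightarrow> (complex \<Rightarrow> complex) \<Rightarrow> bool"
  where "subordinate f g \<longleftrightarrow>
    f holomorphic_on unit_disc \<and> g holomorphic_on unit_disc \<and>
    (\<exists>w. w holomorphic_on unit_disc \<and> w ` unit_disc \<subseteq> unit_disc \<and> w 0 = 0 \<and>
         (\<forall>z\<in>unit_disc. f z = g (w z)))"

end

theory Submission
  imports Defs
begin

text \<open>
  The function $p$ has no zeros, since $z p'(z)/p(z)$ would have a pole there. Put $w = p^2 - 1$, so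
  that $z p'/p = z w'/(2(1 + w))$. If $|w|$ reached $1$, then at a point $z_0$ of least modulus with
  $|w(z_0)| = 1$ we would have $z_0 w'(z_0) = k w(z_0)$ with $k \ge 0$ (a weak form of Jack's lemma),
  and since $1/(1 + w(z_0))$ has real part $1/2$, the left-hand side of the hypothesis would be at
  distance $|1 + \beta k / (2 (1 + w(z_0)))| \ge 1$ from $1$. Hence $|w| < 1$. In particular $p^2$,
  and so by connectedness $p$, has positive real part, whence $p$ is the principal root of $1 + w$.
\<close>

text \<open>At a zero of order n, \<open>p'\<close> vanishes only to order n - 1, while
  \<open>q * p\<close> vanishes to order at least n, so \<open>h\<close> would have to vanish there
  too. The equation is assumed only where \<open>p\<close> is nonzero, so the value given to a
  division by zero cannot enter.\<close>

lemma nonzero_if_log_deriv_holomorphic: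
  fixes p q h :: "complex \<Rightarrow> complex"
  assumes S: "open S" "connected S"
    and p: "p holomorphic_on S"
    and q: "continuous_on S q" and h: "continuous_on S h"
    and eq: "\<And>z. z \<in> S \<Longrightarrow> p z \<noteq> 0 \<Longrightarrow> h z * deriv p z = q z * p z"
    and a: "a \<in> S" "p a \<noteq> 0"
    and z: "z \<in> S" "h z \<noteq> 0"
  shows "p z \<noteq> 0"
proof
  assume pz: "p z = 0"
  have "\<not> p constant_on S"
    using a z pz unfolding constant_on_def by metis
  then obtain g r n where n: "0 < n" and r: "0 < r" "ball z r \<subseteq> S"
    and g: "g holomorphic_on ball z r"
    and fac: "\<And>x. x \<in> ball z r \<Longrightarrow> p x = (x - z) ^ n * g x"
    and g0: "\<And>x. x \<in> ball z r \<Longrightarrow> g x \<noteq> 0"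
    using holomorphic_factor_zero_nonconstant[OF p S z(1) pz] by metis
  \<comment> \<open>Off \<open>z\<close>, \<open>h * deriv p - q * p\<close> equals
    \<open>(x - z) ^ (n - 1) * L x\<close>. Unlike the quotient, \<open>L\<close> is given by a
    formula continuous at \<open>z\<close>, where it takes the value
    \<open>of_nat n * h z * g z\<close>.\<close>
  define L where "L x = h x * (of_nat n * g x + (x - z) * deriv g x) - q x * (x - z) * g x" for x
  have L0: "L x = 0" if x: "x \<in> ball z r - {z}" for x
  proof -
    have xz: "x - z \<noteq> 0" "x \<in> ball z r" using x by auto
    have dg: "(g has_field_derivative deriv g x) (at x)"
      using g xz(2) holomorphic_derivI open_ball by blast
    have "((\<lambda>x. (x - z) ^ n * g x) has_field_derivative
        (of_nat n * (x - z) ^ (n - 1) * g x + (x - z) ^ n * deriv g x)) (at x)"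
      by (rule derivative_eq_intros dg refl)+ simp
    then have "(p has_field_derivative
        (of_nat n * (x - z) ^ (n - 1) * g x + (x - z) ^ n * deriv g x)) (at x)"
      by (rule has_field_derivative_transform_within_open[where S = "ball z r"])
        (use xz fac in auto)
    then have dp: "deriv p x = of_nat n * (x - z) ^ (n - 1) * g x + (x - z) ^ n * deriv g x"
      by (rule DERIV_imp_deriv)
    have pw: "(x - z) ^ n = (x - z) ^ (n - 1) * (x - z)"
      using n by (metis power_minus_mult)
    have "p x \<noteq> 0"
      using fac[OF xz(2)] g0[OF xz(2)] xz(1) by simp
    then have "h x * deriv p x = q x * p x"
      using eq r xz(2) by blast
    then have "(x - z) ^ (n - 1) * L x = 0"
      unfolding dp fac[OF xz(2)] L_def pw by (simp add: algebra_simps)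
    then show ?thesis using xz(1) by simp
  qed
  have "continuous_on (ball z r) L"
    unfolding L_def
    by (intro continuous_intros holomorphic_on_imp_continuous_on[OF g]
        holomorphic_on_imp_continuous_on[OF holomorphic_deriv[OF g open_ball]]
        continuous_on_subset[OF q r(2)] continuous_on_subset[OF h r(2)])
  then have "isCont L z"
    using r(1) by (simp add: continuous_on_eq_continuous_at)
  then have "(L \<longlongrightarrow> L z) (at z)"
    by (simp add: isCont_def)
  moreover have "\<forall>\<^sub>F x in at z. L x = 0"
    using r(1) L0 by (auto simp: eventually_at dist_commute intro!: exI[of _ r])
  ultimately have "L z = 0"
    by (metis tendsto_eventually tendsto_unique trivial_limit_at)
  then show False
    using n z(2) g0[of z] r(1) by (simp add: L_def)
qed

text \<open>On the closed unit disc, |w(z0 c)|^2 is largest at c = 1. Its derivative along the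
  circle vanishes there, which makes the product real; its outward radial derivative is nonnegative,
  which gives the sign. The factor \<open>cnj (w z0)\<close> avoids a division by
  \<open>w z0\<close>.\<close>

lemma weak_Jack:
  fixes w :: "complex \<Rightarrow> complex"
  assumes w': "(w has_field_derivative d) (at z0)"
    and max: "\<And>z. norm z \<le> norm z0 \<Longrightarrow> norm (w z) \<le> norm (w z0)"
  shows "\<exists>k\<ge>0. cnj (w z0) * (z0 * d) = of_real k"
proof -
  have max2: "w (z0 * c) \<bullet> w (z0 * c) \<le> w z0 \<bullet> w z0" if "norm c \<le> 1" for c
    using max[of "z0 * c"] that
    by (simp add: norm_mult mult_left_le norm_le)
  \<comment> \<open>One chain rule serves both curves, \<open>cis\<close> and
    \<open>complex_of_real\<close>, since each passes through 1.\<close>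
  have der: "((\<lambda>t. w (z0 * c t) \<bullet> w (z0 * c t)) has_real_derivative 2 * Re (cnj (w z0) * (z0 * d) * c'))
      (at t0)"
    if c: "(c has_vector_derivative c') (at t0)" and c0: "c t0 = 1" for c c' t0
  proof -
    have "((\<lambda>t. z0 * c t) has_vector_derivative z0 * c') (at t0)"
      by (rule has_vector_derivative_mult_right[OF c])
    moreover have "(w has_field_derivative d) (at (z0 * c t0))"
      using w' c0 by simp
    ultimately have "((w \<circ> (\<lambda>t. z0 * c t)) has_vector_derivative (z0 * c') * d) (at t0)"
      by (rule field_vector_diff_chain_at)
    then have *: "((\<lambda>t. w (z0 * c t)) has_vector_derivative (z0 * c') * d) (at t0)"
      by (simp add: o_def)
    have "((\<lambda>t. w (z0 * c t) \<bullet> w (z0 * c t)) has_real_derivative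
        w (z0 * c t0) \<bullet> ((z0 * c') * d) + ((z0 * c') * d) \<bullet> w (z0 * c t0)) (at t0)"
      unfolding has_real_derivative_iff_has_vector_derivative
      using bounded_bilinear.has_vector_derivative[OF bounded_bilinear_inner * *] .
    moreover have "w (z0 * c t0) \<bullet> ((z0 * c') * d) + ((z0 * c') * d) \<bullet> w (z0 * c t0)
        = 2 * Re (cnj (w z0) * (z0 * d) * c')"
      by (simp add: c0 inner_complex_def algebra_simps)
    ultimately show ?thesis by simp
  qed
  let ?k = "cnj (w z0) * (z0 * d)"
  have "(cis has_vector_derivative \<i>) (at 0)"
    by (auto intro!: derivative_eq_intros simp: has_vector_derivative_complex_iff)
  then have "((\<lambda>t. w (z0 * cis t) \<bullet> w (z0 * cis t)) has_real_derivative 2 * Re (?k * \<i>)) (at 0)"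
    by (rule der) simp
  then have "2 * Re (?k * \<i>) = 0"
    by (rule DERIV_local_max[OF _ zero_less_one]) (use max2 in simp)
  then have im: "Im ?k = 0" by simp
  have "(complex_of_real has_vector_derivative 1) (at 1)"
    by (auto intro!: derivative_eq_intros simp: has_vector_derivative_complex_iff)
  then have rad: "((\<lambda>t. w (z0 * of_real t) \<bullet> w (z0 * of_real t)) has_real_derivative 2 * Re (?k * 1)) (at 1)"
    by (rule der) simp
  \<comment> \<open>Along the radius the maximum is only one-sided, so a negative derivative is
    refuted by a point \<open>1 - h\<close> further in. The bound \<open>h \<le> 1\<close> keeps
    \<open>1 - h\<close> in [0,1].\<close>
  have re: "Re ?k \<ge> 0"
  proof (rule ccontr)
    assume "\<not> Re ?k \<ge> 0"
    then have "2 * Re (?k * 1) < 0" by simp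
    from DERIV_neg_dec_left[OF rad this] obtain e :: real where e: "0 < e"
      and dec: "\<And>h. 0 < h \<Longrightarrow> h < e \<Longrightarrow>
        w (z0 * of_real 1) \<bullet> w (z0 * of_real 1) < w (z0 * of_real (1 - h)) \<bullet> w (z0 * of_real (1 - h))"
      by blast
    define h where "h = min 1 (e / 2)"
    have h: "0 < h" "h < e" "h \<le> 1" using e by (auto simp: h_def)
    have "norm (complex_of_real (1 - h)) \<le> 1"
      using h by (simp only: norm_of_real)
    from max2[OF this] dec[OF h(1,2)] show False by simp
  qed
  have "?k = of_real (Re ?k)"
    using im by (simp add: complex_eq_iff)
  with re show ?thesis by blast
qed

text \<open>The real part is (1 + Re w) / |1 + w|^2, and |1 + w|^2 = 2 (1 + Re w) on the unit
  circle.\<close>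

lemma Re_inverse_one_plus_unit:
  assumes "norm w = 1" "w \<noteq> -1"
  shows "Re (1 / (1 + w)) = 1 / 2"
proof -
  have 1: "(Re w)\<^sup>2 + (Im w)\<^sup>2 = 1"
    using assms(1) by (metis cmod_power2 one_power2)
  have "(1 + Re w)\<^sup>2 + (Im w)\<^sup>2 = 2 * (1 + Re w)"
    using 1 by (simp add: power2_eq_square algebra_simps)
  moreover have "1 + Re w \<noteq> 0"
  proof
    assume a: "1 + Re w = 0"
    then have "Re w = -1" by simp
    with 1 have "Im w = 0" by simp
    with \<open>Re w = -1\<close> assms(2) show False by (simp add: complex_eq_iff)
  qed
  ultimately show ?thesis
    by (simp add: Re_divide)
qed

text \<open>If the bound failed, compactness would give a point \<open>z0\<close> of least modulus
  with |w| at least 1. Since |w| < 1 at all points of smaller modulus, continuity gives |w| at most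
  1 on the closed disc through \<open>z0\<close>, so |w(z0)| = 1, contradicting
  \<open>no\<close>.\<close>

lemma norm_less_1_on_disc_if_no_first_contact:
  fixes w :: "complex \<Rightarrow> complex"
  assumes cont: "continuous_on unit_disc w" and w0: "norm (w 0) < 1"
    and no: "\<And>z0. z0 \<in> unit_disc \<Longrightarrow> norm (w z0) = 1 \<Longrightarrow>
      (\<And>z. norm z \<le> norm z0 \<Longrightarrow> norm (w z) \<le> 1) \<Longrightarrow> False"
    and z: "z \<in> unit_disc"
  shows "norm (w z) < 1"
proof (rule ccontr)
  assume "\<not> norm (w z) < 1"
  define K where "K = cball 0 (norm z) \<inter> (\<lambda>x. norm (w x)) -` {1..}"
  have sub: "cball 0 (norm z) \<subseteq> unit_disc" using z by auto
  have cK: "continuous_on (cball 0 (norm z)) (\<lambda>x. norm (w x))"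
    by (intro continuous_intros continuous_on_subset[OF cont sub])
  have "closed K"
    unfolding K_def by (rule continuous_closed_preimage[OF cK closed_cball closed_atLeast])
  moreover have "bounded K"
    by (rule bounded_subset[OF bounded_cball[of 0 "norm z"]]) (auto simp: K_def)
  ultimately have "compact K" by (simp add: compact_eq_bounded_closed)
  moreover have "K \<noteq> {}" using \<open>\<not> norm (w z) < 1\<close> by (auto simp: K_def)
  ultimately obtain z0 where z0: "z0 \<in> K" and least: "\<And>x. x \<in> K \<Longrightarrow> norm z0 \<le> norm x"
    using continuous_attains_inf[of K norm] continuous_on_norm_id by blast
  have z0d: "z0 \<in> unit_disc" and z0n: "norm z0 \<le> norm z" and ge: "norm (w z0) \<ge> 1"
    using z0 sub by (auto simp: K_def)
  \<comment> \<open>The closure of the open ball is the closed ball only for a nonzero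
    radius.\<close>
  have nz: "z0 \<noteq> 0" using ge w0 by auto
  have lt: "norm (w x) \<le> 1" if "x \<in> ball 0 (norm z0)" for x
    using least[of x] that z0n by (force simp: K_def)
  have cl: "closure (ball 0 (norm z0)) = cball (0::complex) (norm z0)"
    using nz by simp
  have "continuous_on (closure (ball 0 (norm z0))) w"
    unfolding cl by (rule continuous_on_subset[OF cont]) (use z0d in auto)
  from continuous_on_closure_norm_le[OF this, of 1] lt
  have le: "norm (w x) \<le> 1" if "norm x \<le> norm z0" for x
    using that cl by simp
  show False
    using no[OF z0d] le ge by (metis order.antisym order.refl)
qed

text \<open>Where Re p = 0, p^2 is a nonpositive real. Hence Re p has no zero on the connected set
  and keeps its sign.\<close>

lemma Re_pos_if_Re_square_pos:
  fixes p :: "complex \<Rightarrow> complex"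
  assumes "connected S" "continuous_on S p"
    and sq: "\<And>z. z \<in> S \<Longrightarrow> Re ((p z)\<^sup>2) > 0"
    and a: "a \<in> S" "Re (p a) > 0" and z: "z \<in> S"
  shows "Re (p z) > 0"
proof (rule ccontr)
  assume "\<not> Re (p z) > 0"
  have "connected ((\<lambda>z. Re (p z)) ` S)"
    by (intro connected_continuous_image assms continuous_intros)
  moreover have "Re (p z) \<le> 0" using \<open>\<not> Re (p z) > 0\<close> by simp
  ultimately have "0 \<in> (\<lambda>z. Re (p z)) ` S"
    using connectedD_interval[of _ "Re (p z)" "Re (p a)" 0] a z by force
  then obtain x where "x \<in> S" "Re (p x) = 0" by auto
  with sq[of x] show False
    by (simp add: power2_eq_square)
qed

theorem lemma3p7:
  fixes \<beta> :: real and p :: "complex \<Rightarrow> complex"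
  assumes "\<beta> > 0"
    and "p holomorphic_on unit_disc"
    and "p 0 = 1"
    and "subordinate (\<lambda>z. (p z)\<^sup>2 + complex_of_real \<beta> * z * deriv p z / p z) (\<lambda>z. 1 + z)"
  shows "subordinate p (\<lambda>z. csqrt (1 + z))"
proof -
  note p = assms(2)
  define f where "f z = (p z)\<^sup>2 + complex_of_real \<beta> * z * deriv p z / p z" for z
  have f: "f holomorphic_on unit_disc" and f1: "norm (f z - 1) < 1" if "z \<in> unit_disc" for z
    using assms(4) that unfolding subordinate_def f_def[symmetric] by fastforce+
  have cp: "continuous_on unit_disc p" and cf: "continuous_on unit_disc f"
    using p f[of 0] by (auto intro: holomorphic_on_imp_continuous_on)
  have p0: "p z \<noteq> 0" if z: "z \<in> unit_disc" for z
  proof (cases "z = 0")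
    case False
    \<comment> \<open>Where \<open>p\<close> is nonzero, \<beta> z p' = (f - p^2) p. The factor
      \<beta> z vanishes at 0, so that point is treated apart, by \<open>p 0 = 1\<close>.\<close>
    show ?thesis
    proof (rule nonzero_if_log_deriv_holomorphic[OF open_ball connected_ball p, where a = 0])
      show "continuous_on unit_disc (\<lambda>z. f z - (p z)\<^sup>2)"
        by (intro continuous_intros cp cf)
      show "continuous_on unit_disc (\<lambda>z. complex_of_real \<beta> * z)"
        by (intro continuous_intros)
    qed (use False z assms(1,3) in \<open>auto simp: f_def\<close>)
  qed (simp add: assms(3))
  define w where "w z = (p z)\<^sup>2 - 1" for z
  have w: "w holomorphic_on unit_disc"
    unfolding w_def by (intro holomorphic_intros p)
  have w1: "norm (w z) < 1" if "z \<in> unit_disc" for z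
  proof (rule norm_less_1_on_disc_if_no_first_contact[OF holomorphic_on_imp_continuous_on[OF w] _ _ that])
    show "norm (w 0) < 1" by (simp add: w_def assms(3))
  next
    fix z0 assume z0: "z0 \<in> unit_disc" and n1: "norm (w z0) = 1"
      and max: "\<And>z. norm z \<le> norm z0 \<Longrightarrow> norm (w z) \<le> 1"
    have pz: "p z0 \<noteq> 0" by (rule p0[OF z0])
    have "(p has_field_derivative deriv p z0) (at z0)"
      using p z0 holomorphic_derivI open_ball by blast
    then have "(w has_field_derivative 2 * p z0 * deriv p z0) (at z0)"
      unfolding w_def by (auto intro!: derivative_eq_intros)
    from weak_Jack[OF this] max n1 obtain k where k: "k \<ge> 0"
      and "cnj (w z0) * (z0 * (2 * p z0 * deriv p z0)) = of_real k"
      by auto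
    \<comment> \<open>As |w(z0)| = 1, multiplying by \<open>w z0\<close> cancels the conjugate and
      leaves Jack's relation.\<close>
    then have "w z0 * cnj (w z0) * (z0 * (2 * p z0 * deriv p z0)) = w z0 * of_real k"
      by (simp add: mult.assoc)
    then have d: "z0 * (2 * p z0 * deriv p z0) = w z0 * of_real k"
      using n1 by (simp add: complex_norm_square[symmetric])
    define u where "u = 1 / (1 + w z0)"
    have pw: "1 + w z0 = (p z0)\<^sup>2" by (simp add: w_def)
    have "w z0 \<noteq> -1" using pz by (simp add: w_def)
    then have u: "Re u = 1 / 2"
      unfolding u_def using n1 Re_inverse_one_plus_unit by blast
    \<comment> \<open>Expanding by 2p turns p'/p into (p^2)' / (2 p^2), in which (p^2)' = w' and p^2
      = 1 + w.\<close>
    have "complex_of_real \<beta> * z0 * deriv p z0 / p z0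
        = complex_of_real \<beta> / 2 * (z0 * (2 * p z0 * deriv p z0)) * u"
      using pz unfolding u_def pw by (simp add: power2_eq_square)
    then have "f z0 - 1 = w z0 * (1 + of_real (\<beta> * k / 2) * u)"
      unfolding f_def d by (simp add: w_def algebra_simps)
    then have "norm (f z0 - 1) = norm (1 + of_real (\<beta> * k / 2) * u)"
      by (simp only: norm_mult n1 mult_1)
    moreover have "Re (1 + of_real (\<beta> * k / 2) * u) \<ge> 1"
      using assms(1) k by (simp add: u)
    ultimately have "norm (f z0 - 1) \<ge> 1"
      using complex_Re_le_cmod order.trans by metis
    with f1[OF z0] show False by simp
  qed
  have Re_pos: "Re (1 + z) > 0" if "norm z < 1" for z
    using abs_Re_le_cmod[of z] that by simp
  have pos: "Re (p z) > 0" if "z \<in> unit_disc" for z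
  proof (rule Re_pos_if_Re_square_pos[OF connected_ball cp _ _ _ that, of 0])
    show "Re ((p x)\<^sup>2) > 0" if "x \<in> unit_disc" for x
      using Re_pos[OF w1[OF that]] by (simp add: w_def)
  qed (simp_all add: assms(3))
  \<comment> \<open>Positivity of Re p selects the principal root, so \<open>w\<close> itself is the
    map required by the subordination.\<close>
  have "p z = csqrt (1 + w z)" if "z \<in> unit_disc" for z
    using pos[OF that] by (simp add: w_def csqrt_square)
  moreover have "(\<lambda>z. csqrt (1 + z)) holomorphic_on unit_disc"
    using Re_pos by (intro holomorphic_intros) (fastforce simp: complex_nonpos_Reals_iff)
  ultimately show ?thesis
    unfolding subordinate_def using p w w1
    by (intro conjI exI[of _ w]) (auto simp: w_def assms(3))
qed

end
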